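(* Let $n\ge1$ and let $H_1,H_2\in\mathbb{C}_{n\times n}$ be self-adjoint matrices with $\|H_i\|_{op}\le 1$ for $i=1,2$. Then there exist self-adjoint matrices $A_1,A_2\in\mathbb{C}_{n\times n}$ with $[A_1,A_2]=0$ and $\|A_i\|_{op}\le 1$ for $i=1,2$ such that $$\|H_1-A_1\|_{tr}\le 12\left(\|[H_1,H_2]\|_{tr}\right)^{1/6}\quad\text{and}\quad \|H_2-A_2\|_{tr}\le 12\left(\|[H_1,H_2]\|_{tr}\right)^{1/6}.$$ In addition, $A_1$ can be chosen so that also $[A_1,H_1]=0$ (i.e. a single pair $A_1,A_2$ satisfies all of these properties).
   Context: $\mathbb{C}_{n\times n}$ is the set of complex $n\times n$ matrices, $[X,Y]=XY-YX$, $\|A\|_{tr}=\sqrt{\frac1n\sum_{j,k=1}^n|A_{j,k}|^2}$ is the normalized Hilbert-Schmidt norm, and $\|A\|_{op}=\sup\{\|Ax\|:\|x\|=1\}$ is the operator norm with respect to the standard Hilbert space norm on $\mathbb{C}^n$. *)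

theory Defs
  imports "HOL-Analysis.Analysis"
begin

definition conj_transpose :: "complex^'n^'m \<Rightarrow> complex^'m^'n" where
  "conj_transpose A = (\<chi> i j. cnj (A $ j $ i))"

definition self_adjoint :: "complex^'n^'n \<Rightarrow> bool" where
  "self_adjoint A \<longleftrightarrow> conj_transpose A = A"

definition commutator :: "complex^'n^'n \<Rightarrow> complex^'n^'n \<Rightarrow> complex^'n^'n" where
  "commutator X Y = X ** Y - Y ** X"

definition tr_norm :: "complex^'n^'n \<Rightarrow> real" where
  "tr_norm A = sqrt ((1 / real CARD('n)) * (\<Sum>j\<in>UNIV. \<Sum>k\<in>UNIV. (cmod (A $ j $ k))\<^sup>2))"

definition op_norm :: "complex^'n^'n \<Rightarrow> real" where
  "op_norm A = onorm ((*v) A)"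

text \<open>The library's \<^const>\<open>onorm\<close> is a supremum of quotients over all vectors; here it
  agrees with the supremum over unit vectors.\<close>

lemma op_norm_eq_Sup_unit:
  fixes A :: "complex^'n^'n"
  shows "op_norm A = Sup {norm (A *v x) | x. norm x = 1}"
proof -
  have lin: "bounded_linear ((*v) A)"
    by (rule linear_conv_bounded_linear[THEN iffD1])
       (auto intro!: linearI simp: matrix_vector_right_distrib vec_eq_iff
          matrix_vector_mult_def scaleR_sum_right)
  obtain u :: "complex^'n" where u: "norm u = 1"
    using vector_choose_size[of 1] by auto
  let ?S = "{norm (A *v x) | x. norm x = 1}"
  have ub: "y \<le> onorm ((*v) A)" if "y \<in> ?S" for y
  proof -
    from that obtain x where "y = norm (A *v x)" "norm x = 1"
      by auto
    with onorm[OF lin, of x] show ?thesis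
      by simp
  qed
  have bdd: "bdd_above ?S"
    by (rule bdd_aboveI) (rule ub)
  have le: "onorm ((*v) A) \<le> Sup ?S"
  proof (rule onorm_bound)
    show "0 \<le> Sup ?S"
      by (rule order_trans[OF norm_ge_zero[of "A *v u"]], rule cSup_upper)
         (use u bdd in auto)
    fix x :: "complex^'n"
    show "norm (A *v x) \<le> Sup ?S * norm x"
    proof (cases "x = 0")
      case False
      let ?x = "(1 / norm x) *\<^sub>R x"
      have "norm (A *v ?x) \<le> Sup ?S"
        by (rule cSup_upper) (use False bdd in \<open>auto intro!: exI[of _ ?x]\<close>)
      moreover have "A *v ?x = (1 / norm x) *\<^sub>R (A *v x)"
        using bounded_linear.linear[OF lin] linear_cmul by blast
      ultimately show ?thesis
        using False by (simp add: field_simps)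
    qed simp
  qed
  have "Sup ?S \<le> onorm ((*v) A)"
    by (rule cSup_least) (use u ub in auto)
  with le show ?thesis
    by (simp add: op_norm_def)
qed

end

theory Submission
  imports Defs
begin

text \<open>
  Diagonalise \<open>H1\<close>, with eigenvalues \<open>l i\<close>, and cut the real line into intervals of length
  \<open>\<epsilon>\<close>. Let \<open>A1\<close> replace each eigenvalue by a representative of its interval, and let \<open>A2\<close> be
  the pinching of \<open>H2\<close> to the corresponding spectral subspaces. These commute, and \<open>H1\<close> is
  moved by at most \<open>\<epsilon>\<close>. For a random translate of the grid, \<open>l i\<close> and \<open>l j\<close> are separated with
  probability at most \<open>\<bar>l i - l j\<bar> / \<epsilon>\<close>; as the commutator has entries
  \<open>(l i - l j) * H2 $ i $ j\<close>, Cauchy-Schwarz bounds the expected value of the squared distance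
  from \<open>H2\<close> to \<open>A2\<close> by \<open>\<delta> / \<epsilon>\<close>, where \<open>\<delta>\<close> is the norm of the commutator. Taking
  \<open>\<epsilon> = \<delta> powr (1/3)\<close> makes both errors of order \<open>\<delta> powr (1/3)\<close>. Averaging over finitely many
  translates \<open>\<epsilon> * m / M\<close> with \<open>M \<ge> \<epsilon> / \<delta>\<close> costs only a factor \<open>2\<close>.
\<close>

section \<open>Separating numbers by a shifted grid\<close>

text \<open>The summands run over \<open>M\<close> consecutive integers. Moving this window by one
  trades its first element for the integer \<open>M\<close> places further on, whose quotient by
  \<open>M\<close> is larger by exactly 1.\<close>

lemma sum_shifted_div_diff:
  fixes a :: int and M k :: nat
  assumes "0 < M"
  shows "(\<Sum>m<M. (a + int k + int m) div int M) = (\<Sum>m<M. (a + int m) div int M) + int k"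
proof (induction k)
  case (Suc k)
  define f where "f m = (a + int k + int m) div int M" for m :: nat
  have "(\<Sum>m<M. (a + int (Suc k) + int m) div int M) = (\<Sum>m<M. f (Suc m))"
    by (simp add: f_def algebra_simps)
  also have "\<dots> = (\<Sum>m<M. f m) + (f M - f 0)"
    using sum_lessThan_telescope[of f M] by (simp add: sum_subtractf)
  also have "f M - f 0 = 1"
    using assms by (simp add: f_def)
  finally show ?case
    using Suc by (simp add: f_def)
qed simp

text \<open>Quotients are monotone, so for \<open>a \<le> b\<close> each separating shift adds at
  least 1 to the difference of the two sums of quotients, and that difference is exactly
  \<open>b - a\<close>.\<close>

lemma card_separating_shifts_le:
  fixes a b :: int and M :: nat
  assumes "0 < M"
  shows "(\<Sum>m<M. if (a + int m) div int M \<noteq> (b + int m) div int M then 1 else 0 :: int) \<le> \<bar>a - b\<bar>"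
proof -
  have le: "(\<Sum>m<M. if (a + int m) div int M \<noteq> (b + int m) div int M then 1 else 0 :: int) \<le> b - a"
    if "a \<le> b" for a b
  proof -
    have "(\<Sum>m<M. if (a + int m) div int M \<noteq> (b + int m) div int M then 1 else 0 :: int)
        \<le> (\<Sum>m<M. (b + int m) div int M - (a + int m) div int M)"
    proof (rule sum_mono)
      fix m
      have "(a + int m) div int M \<le> (b + int m) div int M"
        using that assms by (intro zdiv_mono1) auto
      then show "(if (a + int m) div int M \<noteq> (b + int m) div int M then 1 else 0 :: int)
        \<le> (b + int m) div int M - (a + int m) div int M"
        by auto
    qed
    also have "\<dots> = b - a"
      using sum_shifted_div_diff[OF assms, of a "nat (b - a)"] that by (simp add: sum_subtractf)
    finally show ?thesis .
  qed
  show ?thesis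
  proof (cases "a \<le> b")
    case True
    then show ?thesis using le[of a b] by simp
  next
    case False
    then show ?thesis using le[of b a] by (simp add: eq_commute)
  qed
qed

text \<open>The separated weight is summed over \<open>M\<close> equally spaced translates of the
  grid, and some translate does no worse than the mean. In the application \<open>w i j\<close> is a
  normalized squared matrix entry and \<open>\<delta>\<close> the norm of the commutator.\<close>

lemma exists_grid_with_few_separated_pairs:
  fixes l :: "'a::finite \<Rightarrow> real" and w :: "'a \<Rightarrow> 'a \<Rightarrow> real"
  assumes w: "\<And>i j. 0 \<le> w i j" and w1: "(\<Sum>i\<in>UNIV. \<Sum>j\<in>UNIV. w i j) \<le> 1"
    and wl: "(\<Sum>i\<in>UNIV. \<Sum>j\<in>UNIV. w i j * (l i - l j)\<^sup>2) \<le> \<delta>\<^sup>2"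
    and "0 < \<delta>" "0 < \<epsilon>"
  shows "\<exists>(b :: 'a \<Rightarrow> int) (r :: int \<Rightarrow> real). (\<forall>i. \<bar>l i - r (b i)\<bar> \<le> \<epsilon>) \<and>
    (\<Sum>i\<in>UNIV. \<Sum>j\<in>UNIV. if b i \<noteq> b j then w i j else 0) \<le> 2 * \<delta> / \<epsilon>"
proof -
  \<comment> \<open>This size of \<open>M\<close> gives
    \<open>1 \<le> M * \<delta> / \<epsilon>\<close>, which absorbs the total rounding error, at
    most 1, in the final estimate.\<close>
  obtain M :: nat where M0: "\<epsilon> / \<delta> < real M"
    using reals_Archimedean2 by blast
  have "0 < real M"
    using M0 assms by (meson divide_pos_pos less_trans)
  then have M: "0 < M" by simp
  \<comment> \<open>In units of \<open>\<epsilon> / M\<close> a cell has length \<open>M\<close>,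
    and translating the grid becomes adding the integer \<open>m\<close>. Then \<open>b m i\<close>
    is the cell containing \<open>l i\<close>, and \<open>r m q\<close> is the left endpoint of cell
    \<open>q\<close>.\<close>
  define a where "a i = \<lfloor>l i * M / \<epsilon>\<rfloor>" for i
  define b where "b m i = (a i + int m) div int M" for m i
  define r where "r m q = \<epsilon> * (of_int q - real m / real M)" for m :: nat and q :: int
  have near: "\<bar>l i - r m (b m i)\<bar> \<le> \<epsilon>" for i m
  proof -
    define q where "q = b m i"
    have eq: "a i + int m = q * int M + (a i + int m) mod int M"
      unfolding q_def b_def by simp
    have md: "0 \<le> (a i + int m) mod int M" "(a i + int m) mod int M < int M"
      using M by auto
    \<comment> \<open>Integrality turns the strict bound on the remainder into a spare unit, which
      covers the fractional part dropped by the floor in \<open>a i\<close>.\<close>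
    have "q * int M - int m \<le> a i" "a i + 1 \<le> q * int M - int m + int M"
      using eq md by linarith+
    then have 1: "of_int (q * int M - int m) \<le> (of_int (a i) :: real)"
      "of_int (a i + 1) \<le> (of_int (q * int M - int m + int M) :: real)"
      by (simp_all only: of_int_le_iff)
    have 2: "of_int (a i) \<le> l i * M / \<epsilon>" "l i * M / \<epsilon> < of_int (a i) + 1"
      unfolding a_def by linarith+
    have "real_of_int q * M - m \<le> l i * M / \<epsilon>" "l i * M / \<epsilon> \<le> real_of_int q * M - m + M"
      using 1 2 by simp_all
    then have "\<epsilon> / M * (real_of_int q * M - m) \<le> \<epsilon> / M * (l i * M / \<epsilon>)"
      "\<epsilon> / M * (l i * M / \<epsilon>) \<le> \<epsilon> / M * (real_of_int q * M - m + M)"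
      using \<open>0 < \<epsilon>\<close> by (intro mult_left_mono; simp)+
    moreover have "\<epsilon> / M * (l i * M / \<epsilon>) = l i" 
      using M \<open>0 < \<epsilon>\<close> by simp
    moreover have "\<epsilon> / M * (real_of_int q * M - m) = r m q"
      "\<epsilon> / M * (real_of_int q * M - m + M) = r m q + \<epsilon>"
      using M by (simp_all add: r_def field_simps)
    ultimately show ?thesis unfolding q_def by simp
  qed
  define S where "S m = (\<Sum>i\<in>UNIV. \<Sum>j\<in>UNIV. if b m i \<noteq> b m j then w i j else 0)" for m
  have pair: "(\<Sum>m<M. if b m i \<noteq> b m j then w i j else 0)
      \<le> w i j * (M / \<epsilon> * (((l i - l j)\<^sup>2 / \<delta> + \<delta>) / 2) + 1)" for i j
  proof -
    have "(\<Sum>m<M. if b m i \<noteq> b m j then w i j else 0)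
        = w i j * of_int (\<Sum>m<M. if b m i \<noteq> b m j then 1 else 0 :: int)"
      by (simp add: sum_distrib_left if_distrib cong: if_cong)
    also have "\<dots> \<le> w i j * of_int \<bar>a i - a j\<bar>"
      using card_separating_shifts_le[OF M, of "a i" "a j"] w
      unfolding b_def by (intro mult_left_mono) (simp_all only: of_int_le_iff)
    also have "\<dots> \<le> w i j * (M / \<epsilon> * (((l i - l j)\<^sup>2 / \<delta> + \<delta>) / 2) + 1)"
    proof (rule mult_left_mono[OF _ w])
      have "of_int \<bar>a i - a j\<bar> \<le> \<bar>l i * M / \<epsilon> - l j * M / \<epsilon>\<bar> + 1"
        unfolding a_def by linarith
      also have "l i * M / \<epsilon> - l j * M / \<epsilon> = M / \<epsilon> * (l i - l j)"
        by (simp add: algebra_simps diff_divide_distrib)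
      also have "\<bar>M / \<epsilon> * (l i - l j)\<bar> = M / \<epsilon> * \<bar>l i - l j\<bar>"
        using \<open>0 < \<epsilon>\<close> by (simp add: abs_mult)
      finally have "of_int \<bar>a i - a j\<bar> \<le> M / \<epsilon> * \<bar>l i - l j\<bar> + 1" .
      \<comment> \<open>The inequality of arithmetic and geometric means, scaled by
        \<open>\<delta>\<close>, does the work of Cauchy-Schwarz: after summation against
        \<open>w\<close>, each of the two halves is at most \<open>\<delta> / 2\<close>.\<close>
      moreover have "\<bar>l i - l j\<bar> \<le> ((l i - l j)\<^sup>2 / \<delta> + \<delta>) / 2"
      proof -
        have "0 \<le> (\<bar>l i - l j\<bar> - \<delta>)\<^sup>2" by simp
        then show ?thesis
          using \<open>0 < \<delta>\<close> by (simp add: field_simps power2_diff) (simp add: power2_eq_square)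
      qed
      then have "M / \<epsilon> * \<bar>l i - l j\<bar> \<le> M / \<epsilon> * (((l i - l j)\<^sup>2 / \<delta> + \<delta>) / 2)"
        using \<open>0 < \<epsilon>\<close> by (intro mult_left_mono) auto
      ultimately show "of_int \<bar>a i - a j\<bar> \<le> M / \<epsilon> * (((l i - l j)\<^sup>2 / \<delta> + \<delta>) / 2) + 1"
        by linarith
    qed
    finally show ?thesis .
  qed
  have "(\<Sum>m<M. S m) = (\<Sum>i\<in>UNIV. \<Sum>j\<in>UNIV. \<Sum>m<M. if b m i \<noteq> b m j then w i j else 0)"
    unfolding S_def by (subst sum.swap) (intro sum.cong refl sum.swap)
  also have "\<dots> \<le> (\<Sum>i\<in>UNIV. \<Sum>j\<in>UNIV. w i j * (M / \<epsilon> * (((l i - l j)\<^sup>2 / \<delta> + \<delta>) / 2) + 1))"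
    by (intro sum_mono pair)
  also have "\<dots> = (\<Sum>i\<in>UNIV. \<Sum>j\<in>UNIV. M / (2 * \<epsilon> * \<delta>) * (w i j * (l i - l j)\<^sup>2)
      + (M * \<delta> / (2 * \<epsilon>) + 1) * w i j)"
    using assms(4,5) by (intro sum.cong refl) (simp add: field_simps)
  also have "\<dots> = M / (2 * \<epsilon> * \<delta>) * (\<Sum>i\<in>UNIV. \<Sum>j\<in>UNIV. w i j * (l i - l j)\<^sup>2)
      + (M * \<delta> / (2 * \<epsilon>) + 1) * (\<Sum>i\<in>UNIV. \<Sum>j\<in>UNIV. w i j)"
    by (simp add: sum.distrib sum_distrib_left)
  also have "\<dots> \<le> M / (2 * \<epsilon> * \<delta>) * \<delta>\<^sup>2 + (M * \<delta> / (2 * \<epsilon>) + 1) * 1"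
    using assms by (intro add_mono mult_left_mono) auto
  also have "\<dots> = M * \<delta> / \<epsilon> + 1"
    using assms(4,5) by (simp add: field_simps power2_eq_square)
  also have "\<dots> \<le> M * (2 * \<delta> / \<epsilon>)"
    using M0 assms(4,5) by (simp add: field_simps)
  finally have total: "(\<Sum>m<M. S m) \<le> M * (2 * \<delta> / \<epsilon>)" .
  have "\<exists>m<M. S m \<le> 2 * \<delta> / \<epsilon>"
  proof (rule ccontr)
    assume "\<not> ?thesis"
    then have "(\<Sum>m<M. 2 * \<delta> / \<epsilon>) < (\<Sum>m<M. S m)"
      using M by (intro sum_strict_mono) auto
    then show False using total by simp
  qed
  then show ?thesis
    using near unfolding S_def by blast
qed

section \<open>Hermitian inner product and the spectral theorem\<close>

text \<open>The library's inner product on complex vectors is only the real part of this form,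
  whereas orthogonality over the complex numbers needs all of it.\<close>

definition hermitian_inner :: "complex^'n \<Rightarrow> complex^'n \<Rightarrow> complex" where
  "hermitian_inner x y = (\<Sum>i\<in>UNIV. cnj (x $ i) * y $ i)"

lemma norm_sq_vec: "(norm (x :: complex^'n))\<^sup>2 = (\<Sum>i\<in>UNIV. (cmod (x $ i))\<^sup>2)"
  by (simp add: norm_vec_def L2_set_def sum_nonneg)

lemma hermitian_inner_self: "hermitian_inner x x = complex_of_real ((norm x)\<^sup>2)"
  unfolding norm_sq_vec
  by (simp add: hermitian_inner_def complex_norm_square mult.commute flip: of_real_power)

lemma inner_eq_Re_hermitian_inner: "x \<bullet> y = Re (hermitian_inner x y)"
  by (simp add: hermitian_inner_def inner_vec_def inner_complex_def)

lemma cnj_hermitian_inner: "cnj (hermitian_inner x y) = hermitian_inner y x"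
  by (simp add: hermitian_inner_def mult.commute)

lemma hermitian_inner_add_right: "hermitian_inner x (y + z) = hermitian_inner x y + hermitian_inner x z"
  by (simp add: hermitian_inner_def algebra_simps sum.distrib)

lemma hermitian_inner_scaleR_right: "hermitian_inner x (c *\<^sub>R y) = c *\<^sub>R hermitian_inner x y"
  by (simp add: hermitian_inner_def scaleR_sum_right)

lemma hermitian_inner_scaleR_left: "hermitian_inner (c *\<^sub>R x) y = c *\<^sub>R hermitian_inner x y"
  by (simp add: hermitian_inner_def scaleR_sum_right)

lemma hermitian_inner_adjoint:
  "hermitian_inner (A *v x) y = hermitian_inner x (conj_transpose A *v y)"
proof -
  have "hermitian_inner (A *v x) y = (\<Sum>i\<in>UNIV. \<Sum>j\<in>UNIV. cnj (A $ i $ j) * cnj (x $ j) * y $ i)"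
    by (simp add: hermitian_inner_def matrix_vector_mult_def sum_distrib_right)
  also have "\<dots> = (\<Sum>j\<in>UNIV. \<Sum>i\<in>UNIV. cnj (A $ i $ j) * cnj (x $ j) * y $ i)"
    by (rule sum.swap)
  also have "\<dots> = hermitian_inner x (conj_transpose A *v y)"
    by (simp add: hermitian_inner_def matrix_vector_mult_def conj_transpose_def sum_distrib_left
        mult_ac)
  finally show ?thesis .
qed

lemma linear_matrix_vector_mult_complex: "linear ((*v) (A :: complex^'n^'m))"
  by (auto intro!: linearI simp: matrix_vector_right_distrib vec_eq_iff
      matrix_vector_mult_def scaleR_sum_right)

lemma self_adjoint_inner:
  assumes "self_adjoint H"
  shows "(H *v x) \<bullet> y = x \<bullet> (H *v y)"
  using assms by (simp add: inner_eq_Re_hermitian_inner hermitian_inner_adjoint self_adjoint_def)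

text \<open>The conditions are rows of a square matrix whose row \<open>r\<close> is zero. With
  trivial kernel it would have a right inverse, but row \<open>r\<close> of any such product
  vanishes.\<close>

lemma exists_nonzero_orthogonal:
  fixes u :: "'n::finite \<Rightarrow> complex^'n"
  assumes "r \<notin> I"
  shows "\<exists>x. x \<noteq> 0 \<and> (\<forall>i\<in>I. hermitian_inner (u i) x = 0)"
proof (rule ccontr)
  assume neg: "\<not> ?thesis"
  define A :: "complex^'n^'n" where "A = (\<chi> i j. if i \<in> I then cnj (u i $ j) else 0)"
  have "x = 0" if "A *v x = 0" for x
  proof -
    have "hermitian_inner (u i) x = 0" if "i \<in> I" for i
    proof -
      have "(A *v x) $ i = hermitian_inner (u i) x"
        using \<open>i \<in> I\<close> by (simp add: A_def matrix_vector_mult_def hermitian_inner_def)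
      then show ?thesis using \<open>A *v x = 0\<close> by simp
    qed
    then show ?thesis using neg by blast
  qed
  then obtain B where "B ** A = mat 1"
    using matrix_left_invertible_ker[of A] by blast
  then have "A ** B = mat 1"
    by (simp add: matrix_left_right_inverse)
  then have "(A ** B) $ r $ r = 1"
    by (simp add: mat_def)
  then show False
    using assms by (simp add: A_def matrix_matrix_mult_def)
qed

text \<open>A maximiser of the quadratic form of \<open>H\<close> on the unit sphere of \<open>W\<close> is an eigenvector.\<close>

lemma self_adjoint_eigenvector_in_invariant_subspace:
  fixes H :: "complex^'n^'n"
  assumes H: "self_adjoint H" and W: "subspace W" "closed W" and inv: "\<And>x. x \<in> W \<Longrightarrow> H *v x \<in> W"
    and z: "z \<in> W" "z \<noteq> 0"
  shows "\<exists>x \<mu>. x \<in> W \<and> norm x = 1 \<and> H *v x = \<mu> *\<^sub>R x"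
proof -
  let ?K = "W \<inter> sphere 0 1"
  \<comment> \<open>For self-adjoint \<open>H\<close> the Hermitian form of \<open>x\<close> and
    \<open>H *v x\<close> is real, so the real inner product loses nothing and the eigenvalue found
    is real.\<close>
  let ?q = "\<lambda>x. x \<bullet> (H *v x)"
  note lin = linear_matrix_vector_mult_complex[of H]
  have "compact ?K"
    using W(2) by (simp add: closed_Int_compact)
  moreover have "(1 / norm z) *\<^sub>R z \<in> ?K"
    using z W(1) by (simp add: subspace_scale)
  moreover have "continuous_on ?K ?q"
    using lin by (intro continuous_intros linear_continuous_on)
      (simp add: linear_conv_bounded_linear)
  ultimately obtain x where x: "x \<in> ?K" and max: "\<And>y. y \<in> ?K \<Longrightarrow> ?q y \<le> ?q x"
    using continuous_attains_sup[of ?K ?q] by blast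
  define \<mu> where "\<mu> = ?q x"
  have nx: "norm x = 1" "x \<bullet> x = 1" "x \<in> W"
    using x by (auto simp: dot_square_norm)
  have quad: "?q y \<le> \<mu> * (y \<bullet> y)" if "y \<in> W" for y
  proof (cases "y = 0")
    case False
    have "(1 / norm y) *\<^sub>R y \<in> ?K"
      using that W(1) False by (simp add: subspace_scale)
    from max[OF this] have "?q y / (norm y)\<^sup>2 \<le> \<mu>"
      by (simp add: linear_cmul[OF lin] \<mu>_def power2_eq_square)
    then show ?thesis
      using False by (simp add: dot_square_norm field_simps)
  qed (simp add: linear_0[OF lin])
  \<comment> \<open>The residual of the eigenvalue equation. It lies in \<open>W\<close>, so
    \<open>x\<close> may be compared with points in its direction.\<close>
  define g where "g = H *v x - \<mu> *\<^sub>R x"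
  have gW: "g \<in> W"
    unfolding g_def using W(1) inv nx by (intro subspace_diff subspace_scale) auto
  define c where "c = ?q g - \<mu> * (g \<bullet> g)"
  \<comment> \<open>The bound \<open>quad\<close> is an equality at \<open>x\<close>. Moving to
    \<open>x + t *\<^sub>R g\<close> leaves the first-order term
    \<open>2 * t * (g \<bullet> g)\<close>, which for small positive \<open>t\<close> would dominate
    unless \<open>g = 0\<close>.\<close>
  have expand: "2 * t * (g \<bullet> g) + t\<^sup>2 * c \<le> 0" for t
  proof -
    have "?q (x + t *\<^sub>R g) \<le> \<mu> * ((x + t *\<^sub>R g) \<bullet> (x + t *\<^sub>R g))"
      using W(1) gW nx by (intro quad subspace_add subspace_scale) auto
    moreover have "?q (x + t *\<^sub>R g) = \<mu> + 2 * t * (g \<bullet> (H *v x)) + t\<^sup>2 * ?q g"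
      using self_adjoint_inner[OF H, of x g]
      by (simp add: linear_add[OF lin] linear_cmul[OF lin] inner_add_left inner_add_right
          \<mu>_def inner_commute power2_eq_square algebra_simps)
    moreover have "(x + t *\<^sub>R g) \<bullet> (x + t *\<^sub>R g) = 1 + 2 * t * (g \<bullet> x) + t\<^sup>2 * (g \<bullet> g)"
      using nx by (simp add: inner_add_left inner_add_right inner_commute power2_eq_square
          algebra_simps)
    moreover have "g \<bullet> (H *v x) = g \<bullet> g + \<mu> * (g \<bullet> x)"
      by (simp add: g_def inner_diff_right)
    ultimately have "\<mu> + 2 * t * (g \<bullet> g + \<mu> * (g \<bullet> x)) + t\<^sup>2 * ?q g
        \<le> \<mu> * (1 + 2 * t * (g \<bullet> x) + t\<^sup>2 * (g \<bullet> g))"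
      by metis
    then show ?thesis
      by (simp add: c_def algebra_simps)
  qed
  have "g \<bullet> g = 0"
  proof (rule ccontr)
    assume "g \<bullet> g \<noteq> 0"
    then have pos: "0 < g \<bullet> g" by simp
    \<comment> \<open>The added 1 keeps \<open>C\<close> positive when \<open>c = 0\<close>. With
      the \<open>t\<close> below, the expansion collapses to
      \<open>t\<^sup>2 * (2 * C + c)\<close>.\<close>
    define C where "C = \<bar>c\<bar> + 1"
    define t where "t = (g \<bullet> g) / C"
    have C: "0 < C" "\<bar>c\<bar> < C" by (simp_all add: C_def)
    have t: "0 < t" "g \<bullet> g = t * C" using pos C by (simp_all add: t_def)
    have "t\<^sup>2 * (2 * C + c) \<le> 0"
      using expand[of t] unfolding t(2) by (simp add: power2_eq_square algebra_simps)
    moreover have "0 < 2 * C + c" using C by linarith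
    ultimately show False
      using t(1) by (simp add: mult_le_0_iff)
  qed
  then show ?thesis
    using nx unfolding g_def by auto
qed

text \<open>The orthogonal complement of the eigenvectors found so far is invariant under
  \<open>H\<close>, and it is nonzero because the index \<open>r\<close> is still free, so it
  contains a further eigenvector. Indexing by subsets of the matrix index type makes
  \<open>I = UNIV\<close> a full basis without counting dimensions.\<close>

lemma self_adjoint_orthonormal_eigenvectors:
  fixes H :: "complex^'n^'n" and I :: "'n set"
  assumes H: "self_adjoint H"
  shows "\<exists>(u :: 'n \<Rightarrow> complex^'n) (l :: 'n \<Rightarrow> real).
    (\<forall>i\<in>I. H *v u i = l i *\<^sub>R u i) \<and>
    (\<forall>i\<in>I. \<forall>j\<in>I. hermitian_inner (u i) (u j) = (if i = j then 1 else 0))"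
  using finite[of I]
proof (induction I rule: finite_induct)
  case (insert r I)
  then obtain u l where eig: "\<And>i. i \<in> I \<Longrightarrow> H *v u i = l i *\<^sub>R u i"
    and orth: "\<And>i j. i \<in> I \<Longrightarrow> j \<in> I \<Longrightarrow> hermitian_inner (u i) (u j) = (if i = j then 1 else 0)"
    by blast
  define W where "W = {x. \<forall>i\<in>I. hermitian_inner (u i) x = 0}"
  have sub: "subspace W"
    unfolding W_def subspace_def
    by (auto simp: hermitian_inner_add_right hermitian_inner_scaleR_right)
       (simp add: hermitian_inner_def)
  have "H *v x \<in> W" if "x \<in> W" for x
  proof -
    have "hermitian_inner (u i) (H *v x) = 0" if "i \<in> I" for i
    proof -
      have "hermitian_inner (u i) (H *v x) = hermitian_inner (H *v u i) x"
        using H by (simp add: hermitian_inner_adjoint self_adjoint_def)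
      then show ?thesis
        using eig[OF that] \<open>x \<in> W\<close> that by (simp add: W_def hermitian_inner_scaleR_left)
    qed
    then show ?thesis by (simp add: W_def)
  qed
  moreover obtain z where "z \<noteq> 0" "z \<in> W"
    using exists_nonzero_orthogonal[OF insert(2), of u] by (auto simp: W_def)
  ultimately obtain x \<mu> where x: "x \<in> W" "norm x = 1" "H *v x = \<mu> *\<^sub>R x"
    using self_adjoint_eigenvector_in_invariant_subspace[OF H sub closed_subspace[OF sub]] by metis
  have xr: "hermitian_inner (u i) x = 0" "hermitian_inner x (u i) = 0" if "i \<in> I" for i
    using x(1) that cnj_hermitian_inner[of "u i" x] by (auto simp: W_def)
  have "hermitian_inner x x = 1"
    using x(2) by (simp add: hermitian_inner_self)
  then show ?case
    using x eig orth xr insert(2)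
    by (intro exI[of _ "u(r := x)"] exI[of _ "l(r := \<mu>)"]) auto
qed auto

definition unitary_matrix :: "complex^'n^'n \<Rightarrow> bool" where
  "unitary_matrix U \<longleftrightarrow> conj_transpose U ** U = mat 1 \<and> U ** conj_transpose U = mat 1"

definition real_diag :: "('n \<Rightarrow> real) \<Rightarrow> complex^'n^'n" where
  "real_diag l = (\<chi> i j. if i = j then complex_of_real (l i) else 0)"

text \<open>The eigenvectors are the columns of \<open>U\<close>, so
  \<open>conj_transpose U ** U\<close> is their Gram matrix.\<close>

theorem self_adjoint_unitarily_diagonalizable:
  fixes H :: "complex^'n^'n"
  assumes "self_adjoint H"
  shows "\<exists>U l. unitary_matrix U \<and> conj_transpose U ** H ** U = real_diag l"
proof -
  obtain u :: "'n \<Rightarrow> complex^'n" and l :: "'n \<Rightarrow> real"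
    where eig: "\<And>i. H *v u i = l i *\<^sub>R u i"
    and orth: "\<And>i j. hermitian_inner (u i) (u j) = (if i = j then 1 else 0)"
    using self_adjoint_orthonormal_eigenvectors[OF assms, of UNIV] by auto
  define U :: "complex^'n^'n" where "U = (\<chi> i j. u j $ i)"
  have 1: "conj_transpose U ** U = mat 1"
    using orth by (simp add: vec_eq_iff matrix_matrix_mult_def conj_transpose_def U_def mat_def
        hermitian_inner_def)
  then have "unitary_matrix U"
    by (simp add: unitary_matrix_def matrix_left_right_inverse)
  moreover have "H ** U = (\<chi> i j. l j *\<^sub>R u j $ i)"
    using eig by (simp add: vec_eq_iff matrix_matrix_mult_def U_def matrix_vector_mult_def)
  then have "conj_transpose U ** (H ** U) = real_diag l"
    using orth
    by (simp add: vec_eq_iff matrix_matrix_mult_def conj_transpose_def U_def real_diag_def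
        hermitian_inner_def scaleR_sum_right[symmetric])
       (simp add: scaleR_conv_of_real)
  ultimately show ?thesis
    by (auto simp: matrix_mul_assoc)
qed

section \<open>Norms of matrices\<close>

lemma conj_transpose_mult: "conj_transpose (A ** B) = conj_transpose B ** conj_transpose A"
  by (simp add: vec_eq_iff conj_transpose_def matrix_matrix_mult_def mult.commute)

lemma conj_transpose_conj_transpose: "conj_transpose (conj_transpose A) = A"
  by (simp add: vec_eq_iff conj_transpose_def)

lemma unitary_matrix_conj_transpose: "unitary_matrix U \<Longrightarrow> unitary_matrix (conj_transpose U)"
  by (simp add: unitary_matrix_def conj_transpose_conj_transpose)

lemma norm_unitary_mult:
  assumes "unitary_matrix U"
  shows "norm (U *v x) = norm x"
proof -
  have "hermitian_inner (U *v x) (U *v x) = hermitian_inner x x"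
    using assms
    by (simp add: hermitian_inner_adjoint matrix_vector_mul_assoc unitary_matrix_def)
  then have "(norm (U *v x))\<^sup>2 = (norm x)\<^sup>2"
    by (simp only: hermitian_inner_self of_real_eq_iff)
  then show ?thesis by simp
qed

text \<open>Later bounds on \<open>op_norm\<close> all rest on this pointwise form, which avoids
  suprema.\<close>

lemma op_norm_le_1_iff: "op_norm A \<le> 1 \<longleftrightarrow> (\<forall>x. norm (A *v x) \<le> norm x)"
proof
  assume "op_norm A \<le> 1"
  then have "onorm ((*v) A) * norm x \<le> norm x" for x :: "complex^'a"
    using mult_right_mono[of "onorm ((*v) A)" 1 "norm x"] by (simp add: op_norm_def)
  then show "\<forall>x. norm (A *v x) \<le> norm x"
    using onorm[of "(*v) A"] linear_matrix_vector_mult_complex[of A]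
    by (meson linear_conv_bounded_linear order_trans)
qed (auto simp: op_norm_def intro: onorm_bound)

text \<open>With the sum of squares written as a trace, its unitary invariance follows from
  cyclicity of the trace.\<close>

lemma trace_mult_conj_transpose:
  "trace (A ** conj_transpose A) = complex_of_real (\<Sum>j\<in>UNIV. \<Sum>k\<in>UNIV. (cmod (A $ j $ k))\<^sup>2)"
  by (simp add: trace_def matrix_matrix_mult_def conj_transpose_def complex_norm_square
      flip: of_real_power)

lemma unitary_conj_diff: "U ** (A - B) ** V = U ** A ** V - U ** B ** (V :: complex^'n^'n)"
  by (simp add: vec_eq_iff matrix_matrix_mult_def left_diff_distrib right_diff_distrib sum_subtractf)

lemma unitary_conj_mult:
  assumes "unitary_matrix U"
  shows "(U ** A ** conj_transpose U) ** (U ** B ** conj_transpose U) = U ** (A ** B) ** conj_transpose U"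
proof -
  have "(U ** A ** conj_transpose U) ** (U ** B ** conj_transpose U)
      = U ** A ** (conj_transpose U ** U) ** B ** conj_transpose U"
    by (simp only: matrix_mul_assoc)
  then show ?thesis
    using assms by (simp add: unitary_matrix_def) (simp add: matrix_mul_assoc)
qed

lemma unitary_conj_commutator:
  assumes "unitary_matrix U"
  shows "commutator (U ** A ** conj_transpose U) (U ** B ** conj_transpose U)
    = U ** commutator A B ** conj_transpose U"
  using assms by (simp add: commutator_def unitary_conj_mult unitary_conj_diff)

lemma unitary_conj_self_adjoint:
  "self_adjoint A \<Longrightarrow> self_adjoint (U ** A ** conj_transpose U)"
  by (simp add: self_adjoint_def conj_transpose_mult conj_transpose_conj_transpose matrix_mul_assoc)

lemma unitary_conj_op_norm_le_1:
  assumes "unitary_matrix U" "op_norm A \<le> 1"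
  shows "op_norm (U ** A ** conj_transpose U) \<le> 1"
proof -
  have "norm (U *v (A *v (conj_transpose U *v x))) \<le> norm x" for x
    using assms norm_unitary_mult unitary_matrix_conj_transpose
    by (metis op_norm_le_1_iff)
  then show ?thesis
    by (simp add: op_norm_le_1_iff matrix_vector_mul_assoc matrix_mul_assoc)
qed

lemma unitary_conj_tr_norm:
  assumes "unitary_matrix U"
  shows "tr_norm (U ** A ** conj_transpose U) = tr_norm A"
proof -
  let ?B = "U ** A ** conj_transpose U"
  have "conj_transpose ?B = U ** conj_transpose A ** conj_transpose U"
    by (simp add: conj_transpose_mult conj_transpose_conj_transpose matrix_mul_assoc)
  then have "trace (?B ** conj_transpose ?B) = trace (U ** (A ** conj_transpose A) ** conj_transpose U)"
    using assms by (simp add: unitary_conj_mult)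
  also have "\<dots> = trace (conj_transpose U ** (U ** (A ** conj_transpose A)))"
    by (rule trace_mul_sym)
  also have "\<dots> = trace (A ** conj_transpose A)"
    using assms by (simp add: matrix_mul_assoc unitary_matrix_def)
  finally have "(\<Sum>j\<in>UNIV. \<Sum>k\<in>UNIV. (cmod (?B $ j $ k))\<^sup>2) = (\<Sum>j\<in>UNIV. \<Sum>k\<in>UNIV. (cmod (A $ j $ k))\<^sup>2)"
    by (simp only: trace_mult_conj_transpose of_real_eq_iff)
  then show ?thesis
    by (simp add: tr_norm_def)
qed

lemma tr_norm_nonneg: "0 \<le> tr_norm A"
  by (simp add: tr_norm_def sum_nonneg)

lemma tr_norm_sq:
  "(tr_norm (A :: complex^'n^'n))\<^sup>2 = (\<Sum>j\<in>UNIV. \<Sum>k\<in>UNIV. (cmod (A $ j $ k))\<^sup>2 / real CARD('n))"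
  by (simp add: tr_norm_def sum_nonneg sum_divide_distrib)

text \<open>Column \<open>k\<close> is the image of the \<open>k\<close>-th standard basis vector,
  so its squared norm is at most 1; the normalization averages over the columns.\<close>

lemma tr_norm_le_1:
  fixes A :: "complex^'n^'n"
  assumes "op_norm A \<le> 1"
  shows "tr_norm A \<le> 1"
proof -
  have "(\<Sum>j\<in>UNIV. (cmod (A $ j $ k))\<^sup>2) \<le> 1" for k
  proof -
    have "(A *v axis k 1) $ j = A $ j $ k" for j
      by (simp add: matrix_vector_mult_def axis_def if_distrib cong: if_cong)
    then have "(\<Sum>j\<in>UNIV. (cmod (A $ j $ k))\<^sup>2) = (norm (A *v axis k 1))\<^sup>2"
      by (simp add: norm_sq_vec)
    also have "\<dots> \<le> (norm (axis k 1 :: complex^'n))\<^sup>2"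
      using assms unfolding op_norm_le_1_iff by (intro power_mono norm_ge_zero) blast
    finally show ?thesis by simp
  qed
  then have "(\<Sum>k\<in>UNIV. \<Sum>j\<in>UNIV. (cmod (A $ j $ k))\<^sup>2) \<le> (\<Sum>k\<in>(UNIV::'n set). 1)"
    by (intro sum_mono)
  then have "(\<Sum>j\<in>UNIV. \<Sum>k\<in>UNIV. (cmod (A $ j $ k))\<^sup>2) \<le> real CARD('n)"
    by (subst sum.swap) simp
  then show ?thesis
    by (simp add: tr_norm_def)
qed

section \<open>Diagonal matrices and pinching\<close>

lemma self_adjoint_real_diag: "self_adjoint (real_diag l)"
  by (simp add: self_adjoint_def conj_transpose_def real_diag_def vec_eq_iff)

lemma real_diag_mult: "(real_diag l ** A) $ i $ j = complex_of_real (l i) * A $ i $ j"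
proof -
  have "(real_diag l ** A) $ i $ j = (\<Sum>k\<in>UNIV. if k = i then complex_of_real (l i) * A $ i $ j else 0)"
    unfolding matrix_matrix_mult_def real_diag_def vec_lambda_beta by (intro sum.cong) auto
  then show ?thesis by simp
qed

lemma mult_real_diag: "(A ** real_diag l) $ i $ j = A $ i $ j * complex_of_real (l j)"
proof -
  have "(A ** real_diag l) $ i $ j = (\<Sum>k\<in>UNIV. if k = j then A $ i $ j * complex_of_real (l j) else 0)"
    unfolding matrix_matrix_mult_def real_diag_def vec_lambda_beta by (intro sum.cong) auto
  then show ?thesis by simp
qed

lemma commutator_real_diag:
  "commutator (real_diag l) A $ i $ j = complex_of_real (l i - l j) * A $ i $ j"
  by (simp add: commutator_def real_diag_mult mult_real_diag algebra_simps)

lemma commutator_real_diag_real_diag: "commutator (real_diag c) (real_diag l) = 0"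
  unfolding vec_eq_iff commutator_real_diag by (auto simp: real_diag_def)

lemma real_diag_vec: "(real_diag l *v x) $ i = complex_of_real (l i) * x $ i"
proof -
  have "(real_diag l *v x) $ i = (\<Sum>k\<in>UNIV. if k = i then complex_of_real (l i) * x $ i else 0)"
    unfolding matrix_vector_mult_def real_diag_def vec_lambda_beta by (intro sum.cong) auto
  then show ?thesis by simp
qed

lemma op_norm_real_diag_le_1_iff: "op_norm (real_diag l) \<le> 1 \<longleftrightarrow> (\<forall>i. \<bar>l i\<bar> \<le> 1)"
proof
  assume *: "op_norm (real_diag l) \<le> 1"
  show "\<forall>i. \<bar>l i\<bar> \<le> 1"
  proof
    fix i
    have "\<bar>l i\<bar> = cmod ((real_diag l *v axis i 1) $ i)"
      by (simp add: real_diag_vec)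
    also have "\<dots> \<le> norm (real_diag l *v axis i 1)"
      by (rule Finite_Cartesian_Product.norm_nth_le)
    also have "\<dots> \<le> norm (axis i 1 :: complex^'a)"
      using * unfolding op_norm_le_1_iff by blast
    finally show "\<bar>l i\<bar> \<le> 1" by simp
  qed
next
  assume *: "\<forall>i. \<bar>l i\<bar> \<le> 1"
  have "norm (real_diag l *v x) \<le> norm x" for x :: "complex^'a"
    using * by (intro norm_le_componentwise_cart)
      (simp add: real_diag_vec norm_mult mult_left_le_one_le)
  then show "op_norm (real_diag l) \<le> 1"
    by (simp add: op_norm_le_1_iff)
qed

text \<open>This is the sum over \<open>q\<close> of \<open>P q ** A ** P q\<close>, where
  \<open>P q\<close> is the coordinate projection onto the indices labelled \<open>q\<close> by
  \<open>b\<close>.\<close>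

definition pinching :: "('n \<Rightarrow> 'b) \<Rightarrow> complex^'n^'n \<Rightarrow> complex^'n^'n" where
  "pinching b A = (\<chi> i j. if b i = b j then A $ i $ j else 0)"

lemma self_adjoint_pinching: "self_adjoint A \<Longrightarrow> self_adjoint (pinching b A)"
  by (simp add: self_adjoint_def conj_transpose_def pinching_def vec_eq_iff)

text \<open>The diagonal matrix is scalar on each block of \<open>b\<close>, and pinching keeps only
  entries inside blocks.\<close>

lemma commutator_real_diag_pinching: "commutator (real_diag (\<lambda>i. r (b i))) (pinching b A) = 0"
  unfolding vec_eq_iff commutator_real_diag by (simp add: pinching_def)

text \<open>When \<open>x\<close> is cut into its blocks \<open>y q\<close>, block \<open>q\<close>
  of the image is a part of \<open>A *v y q\<close>. The blocks are orthogonal, so squared norms add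
  up.\<close>

lemma op_norm_pinching_le_1:
  fixes A :: "complex^'n^'n"
  assumes "op_norm A \<le> 1"
  shows "op_norm (pinching b A) \<le> 1"
proof -
  have "norm (pinching b A *v x) \<le> norm x" for x
  proof -
    define y where "y q = (\<chi> i. if b i = q then x $ i else 0)" for q
    have block: "(pinching b A *v x) $ i = (A *v y (b i)) $ i" for i
      unfolding matrix_vector_mult_def pinching_def y_def by (auto intro!: sum.cong)
    have *: "(\<Sum>i\<in>UNIV. f i) = (\<Sum>q\<in>range b. \<Sum>i | b i = q. f i)" for f :: "'n \<Rightarrow> real"
      using sum.group[of UNIV "range b" b f] by simp
    have "(norm (pinching b A *v x))\<^sup>2 = (\<Sum>q\<in>range b. \<Sum>i | b i = q. (cmod ((A *v y q) $ i))\<^sup>2)"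
      unfolding norm_sq_vec block * by (intro sum.cong) auto
    also have "\<dots> \<le> (\<Sum>q\<in>range b. (norm (A *v y q))\<^sup>2)"
      unfolding norm_sq_vec by (intro sum_mono sum_mono2) auto
    also have "\<dots> \<le> (\<Sum>q\<in>range b. (norm (y q))\<^sup>2)"
      using assms by (intro sum_mono power_mono) (auto simp: op_norm_le_1_iff)
    also have "\<dots> = (\<Sum>q\<in>range b. \<Sum>i | b i = q. (cmod (x $ i))\<^sup>2)"
      unfolding norm_sq_vec y_def
      by (intro sum.cong refl sum.mono_neutral_cong_right) auto
    also have "\<dots> = (norm x)\<^sup>2"
      unfolding norm_sq_vec by (rule *[symmetric])
    finally show ?thesis
      by (rule power2_le_imp_le) simp
  qed
  then show ?thesis
    by (simp add: op_norm_le_1_iff)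
qed

lemma tr_norm_real_diag_diff_le:
  assumes "\<And>i. \<bar>l i - c i\<bar> \<le> \<epsilon>"
  shows "tr_norm (real_diag l - real_diag c :: complex^'n^'n) \<le> \<epsilon>"
proof -
  \<comment> \<open>The index type is inhabited, so a single instance of the hypothesis gives the
    sign of \<open>\<epsilon>\<close>.\<close>
  have e: "0 \<le> \<epsilon>"
    using assms[of undefined] by linarith
  have "(\<Sum>k\<in>UNIV. (cmod ((real_diag l - real_diag c :: complex^'n^'n) $ j $ k))\<^sup>2) \<le> \<epsilon>\<^sup>2" for j
  proof -
    have "(\<Sum>k\<in>UNIV. (cmod ((real_diag l - real_diag c :: complex^'n^'n) $ j $ k))\<^sup>2)
        = (\<Sum>k\<in>UNIV. if k = j then \<bar>l j - c j\<bar>\<^sup>2 else 0)"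
      by (intro sum.cong) (auto simp: real_diag_def simp flip: of_real_diff)
    also have "\<dots> = \<bar>l j - c j\<bar>\<^sup>2" by simp
    also have "\<dots> \<le> \<epsilon>\<^sup>2"
      by (rule power_mono[OF assms]) simp
    finally show ?thesis .
  qed
  then have "(\<Sum>j\<in>UNIV. \<Sum>k\<in>UNIV. (cmod ((real_diag l - real_diag c :: complex^'n^'n) $ j $ k))\<^sup>2)
      \<le> (\<Sum>j\<in>(UNIV :: 'n set). \<epsilon>\<^sup>2)"
    by (intro sum_mono)
  then have "(tr_norm (real_diag l - real_diag c :: complex^'n^'n))\<^sup>2 \<le> \<epsilon>\<^sup>2"
    unfolding tr_norm_sq by (simp add: sum_divide_distrib[symmetric] field_simps)
  then show ?thesis
    using e by (rule power2_le_imp_le)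
qed

section \<open>Commuting approximation for a diagonal matrix, and reduction to that case\<close>

text \<open>The grid width \<open>\<epsilon>\<close> stays free so that the two errors can be
  balanced later. The weights \<open>w\<close> sum to the squared norm of \<open>K\<close>, and
  multiplied by the squared gaps of \<open>l\<close> they sum to that of the commutator.\<close>

lemma commuting_approximation_diagonal:
  fixes l :: "'n::finite \<Rightarrow> real" and K :: "complex^'n^'n"
  assumes l: "\<And>i. \<bar>l i\<bar> \<le> 1" and K: "self_adjoint K" "op_norm K \<le> 1"
    and pos: "0 < tr_norm (commutator (real_diag l) K)" and "0 < \<epsilon>"
  shows "\<exists>c B. (\<forall>i. \<bar>c i\<bar> \<le> 1) \<and> self_adjoint B \<and> op_norm B \<le> 1 \<and>
    commutator (real_diag c) B = 0 \<and> tr_norm (real_diag l - real_diag c :: complex^'n^'n) \<le> \<epsilon> \<and>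
    (tr_norm (K - B))\<^sup>2 \<le> 2 * tr_norm (commutator (real_diag l) K) / \<epsilon>"
proof -
  define \<delta> where "\<delta> = tr_norm (commutator (real_diag l) K)"
  define w where "w i j = (cmod (K $ i $ j))\<^sup>2 / real CARD('n)" for i j
  have "(\<Sum>i\<in>UNIV. \<Sum>j\<in>UNIV. w i j) = (tr_norm K)\<^sup>2"
    by (simp add: w_def tr_norm_sq)
  also have "\<dots> \<le> 1"
    using tr_norm_le_1[OF K(2)] tr_norm_nonneg[of K] by (simp add: power_le_one)
  finally have w1: "(\<Sum>i\<in>UNIV. \<Sum>j\<in>UNIV. w i j) \<le> 1" .
  have "\<delta>\<^sup>2 = (\<Sum>i\<in>UNIV. \<Sum>j\<in>UNIV. w i j * (l i - l j)\<^sup>2)"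
    unfolding \<delta>_def tr_norm_sq commutator_real_diag norm_mult norm_of_real
    by (simp add: w_def power_mult_distrib mult.commute)
  then have wl: "(\<Sum>i\<in>UNIV. \<Sum>j\<in>UNIV. w i j * (l i - l j)\<^sup>2) \<le> \<delta>\<^sup>2"
    by simp
  have "0 < \<delta>" using pos by (simp add: \<delta>_def)
  obtain b :: "'n \<Rightarrow> int" and r where near: "\<And>i. \<bar>l i - r (b i)\<bar> \<le> \<epsilon>"
    and few: "(\<Sum>i\<in>UNIV. \<Sum>j\<in>UNIV. if b i \<noteq> b j then w i j else 0) \<le> 2 * \<delta> / \<epsilon>"
    using exists_grid_with_few_separated_pairs[OF _ w1 wl \<open>0 < \<delta>\<close> \<open>0 < \<epsilon>\<close>] by (auto simp: w_def)
  \<comment> \<open>A left endpoint may fall outside the interval from -1 to 1. Clamping restores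
    the norm bound, and since every \<open>l i\<close> lies in that interval, it moves no
    representative away from its eigenvalues.\<close>
  define r' where "r' q = max (-1) (min 1 (r q))" for q
  have r': "\<bar>r' q\<bar> \<le> 1" for q by (auto simp: r'_def)
  have near': "\<bar>l i - r' (b i)\<bar> \<le> \<epsilon>" for i
    using near[of i] l[of i] unfolding r'_def by linarith
  have "(tr_norm (K - pinching b K))\<^sup>2 = (\<Sum>i\<in>UNIV. \<Sum>j\<in>UNIV. if b i \<noteq> b j then w i j else 0)"
    unfolding tr_norm_sq by (intro sum.cong refl) (simp add: pinching_def w_def)
  with few have "(tr_norm (K - pinching b K))\<^sup>2 \<le> 2 * \<delta> / \<epsilon>"
    by simp
  then show ?thesis
    using r' tr_norm_real_diag_diff_le[OF near'] commutator_real_diag_pinching[of r' b K]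
      self_adjoint_pinching[OF K(1), of b] op_norm_pinching_le_1[OF K(2), of b]
    by (intro exI[of _ "\<lambda>i. r' (b i)"] exI[of _ "pinching b K"]) (simp add: \<delta>_def)
qed

theorem theorem3:
  fixes H1 H2 :: "complex^'n^'n"
  assumes "self_adjoint H1" and "self_adjoint H2"
    and "op_norm H1 \<le> 1" and "op_norm H2 \<le> 1"
  shows "\<exists>A1 A2 :: complex^'n^'n.
    self_adjoint A1 \<and> self_adjoint A2 \<and>
    commutator A1 A2 = 0 \<and>
    op_norm A1 \<le> 1 \<and> op_norm A2 \<le> 1 \<and>
    tr_norm (H1 - A1) \<le> 12 * (tr_norm (commutator H1 H2)) powr (1/6) \<and>
    tr_norm (H2 - A2) \<le> 12 * (tr_norm (commutator H1 H2)) powr (1/6) \<and>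
    commutator A1 H1 = 0"
proof -
  define \<delta> where "\<delta> = tr_norm (commutator H1 H2)"
  have "0 \<le> \<delta>"
    by (simp add: \<delta>_def tr_norm_nonneg)
  \<comment> \<open>For \<open>\<delta> = 0\<close> the bound is \<open>0\<close> and the matrices
    already commute; for \<open>1 \<le> \<delta>\<close> it is at least 12 and zero matrices
    suffice. The grid needs \<open>\<delta>\<close> positive, and comparing exponents needs it below
    1.\<close>
  then consider "\<delta> = 0" | "1 \<le> \<delta>" | "0 < \<delta>" "\<delta> < 1"
    by linarith
  then show ?thesis
  proof cases
    case 1
    have "(\<Sum>j\<in>UNIV. \<Sum>k\<in>UNIV. (cmod (commutator H1 H2 $ j $ k))\<^sup>2) = 0"
      using 1 by (simp add: \<delta>_def tr_norm_def)
    then have "commutator H1 H2 = 0"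
      by (simp add: vec_eq_iff sum_nonneg_eq_0_iff sum_nonneg)
    then show ?thesis
      using assms by (intro exI[of _ H1] exI[of _ H2]) (simp add: tr_norm_def commutator_def)
  next
    case 2
    then have "1 \<le> \<delta> powr (1/6)"
      by (simp add: ge_one_powr_ge_zero)
    then have "tr_norm H1 \<le> 12 * \<delta> powr (1/6)" "tr_norm H2 \<le> 12 * \<delta> powr (1/6)"
      using tr_norm_le_1[OF assms(3)] tr_norm_le_1[OF assms(4)] by linarith+
    then show ?thesis
      unfolding \<delta>_def
      by (intro exI[of _ 0])
        (simp add: commutator_def self_adjoint_def conj_transpose_def vec_eq_iff op_norm_le_1_iff)
  next
    case 3
    obtain U l where U: "unitary_matrix U" and D: "conj_transpose U ** H1 ** U = real_diag l"
      using self_adjoint_unitarily_diagonalizable[OF assms(1)] by blast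
    \<comment> \<open>The conjugation lemmas have the form
      \<open>U ** A ** conj_transpose U\<close>; naming the adjoint lets them serve both for passing
      to the eigenbasis and for returning.\<close>
    define V where "V = conj_transpose U"
    have V: "unitary_matrix V" "conj_transpose V = U"
      using U by (simp_all add: V_def unitary_matrix_conj_transpose conj_transpose_conj_transpose)
    define K where "K = V ** H2 ** conj_transpose V"
    have H1': "real_diag l = V ** H1 ** conj_transpose V"
      using D by (simp add: V V_def[symmetric])
    have cancel: "U ** (V ** A ** conj_transpose V) ** conj_transpose U = A" for A
    proof -
      have "U ** (V ** A ** conj_transpose V) ** conj_transpose U = (U ** V) ** A ** (U ** V)"
        by (simp add: V(2) V_def[symmetric] matrix_mul_assoc)
      then show ?thesis
        using U by (simp add: unitary_matrix_def V_def)
    qed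
    have H1: "H1 = U ** real_diag l ** conj_transpose U" and H2: "H2 = U ** K ** conj_transpose U"
      by (simp_all add: H1' K_def cancel)
    have d: "tr_norm (commutator (real_diag l) K) = \<delta>"
      unfolding \<delta>_def H1' K_def unitary_conj_commutator[OF V(1)] unitary_conj_tr_norm[OF V(1)] ..
    have l: "\<bar>l i\<bar> \<le> 1" for i
      using unitary_conj_op_norm_le_1[OF V(1) assms(3)]
      by (simp add: H1'[symmetric] op_norm_real_diag_le_1_iff)
    have K: "self_adjoint K" "op_norm K \<le> 1"
      unfolding K_def using V(1) assms by (simp_all add: unitary_conj_self_adjoint unitary_conj_op_norm_le_1)
    \<comment> \<open>The two errors are at most \<open>\<epsilon>\<close> and
      \<open>sqrt (2 * \<delta> / \<epsilon>)\<close>; this choice makes both bounds constant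
      multiples of \<open>\<delta> powr (1/3)\<close>.\<close>
    define \<epsilon> where "\<epsilon> = \<delta> powr (1/3)"
    have e: "0 < \<epsilon>" using 3 by (simp add: \<epsilon>_def)
    have "0 < tr_norm (commutator (real_diag l) K)"
      using 3 d by simp
    from commuting_approximation_diagonal[OF l K this e]
    obtain c B where c: "\<forall>i. \<bar>c i\<bar> \<le> 1" and B: "self_adjoint B" "op_norm B \<le> 1"
      and com: "commutator (real_diag c) B = 0"
      and n1: "tr_norm (real_diag l - real_diag c :: complex^'n^'n) \<le> \<epsilon>"
      and n2: "(tr_norm (K - B))\<^sup>2 \<le> 2 * \<delta> / \<epsilon>"
      unfolding d by blast
    have small: "\<epsilon> \<le> \<delta> powr (1/6)"
      unfolding \<epsilon>_def using 3 by (intro powr_mono') auto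
    have "2 * \<delta> / \<epsilon> = 2 * \<epsilon>\<^sup>2"
    proof -
      have "\<epsilon> * \<epsilon>\<^sup>2 = \<delta> powr (1/3 + 1/3 + 1/3)"
        unfolding \<epsilon>_def power2_eq_square powr_add by (simp add: mult.assoc)
      then have "\<epsilon> * \<epsilon>\<^sup>2 = \<delta>" using 3 by simp
      then show ?thesis using e by (simp add: field_simps)
    qed
    \<comment> \<open>The factor \<open>sqrt 2\<close> is rounded up to 2, well within the constant
      12.\<close>
    then have "(tr_norm (K - B))\<^sup>2 \<le> (2 * \<epsilon>)\<^sup>2"
      using n2 by (simp add: power_mult_distrib) (smt (verit) zero_le_power2)
    then have n2': "tr_norm (K - B) \<le> 2 * \<epsilon>"
      using e by (auto intro: power2_le_imp_le)
    let ?A1 = "U ** real_diag c ** conj_transpose U"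
    let ?A2 = "U ** B ** conj_transpose U"
    have "tr_norm (H1 - ?A1) \<le> 12 * \<delta> powr (1/6)" "tr_norm (H2 - ?A2) \<le> 12 * \<delta> powr (1/6)"
      unfolding H1 H2 unitary_conj_diff[symmetric] unitary_conj_tr_norm[OF U]
      using n1 n2' small e by linarith+
    moreover have "commutator ?A1 ?A2 = 0"
      unfolding unitary_conj_commutator[OF U] com by simp
    moreover have "commutator ?A1 H1 = 0"
      unfolding H1 unitary_conj_commutator[OF U] commutator_real_diag_real_diag by simp
    moreover have "op_norm ?A1 \<le> 1" "op_norm ?A2 \<le> 1"
      using U B c by (simp_all add: unitary_conj_op_norm_le_1 op_norm_real_diag_le_1_iff)
    moreover have "self_adjoint ?A1" "self_adjoint ?A2"
      using B by (simp_all add: unitary_conj_self_adjoint self_adjoint_real_diag)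
    ultimately show ?thesis
      unfolding \<delta>_def by blast
  qed
qed

end
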